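(* Assume $\diamondsuit^+$. Let $G$ be an undirected graph with $|V(G)|=\chi(G)=\omega_1$. Then there is an orientation $D^*$ of $G$ such that whenever $A\subseteq V(G)$ satisfies $\chi(G[A])=\omega_1$ and $D$ is any orientation of the half graph $H_{\omega,\omega}$, $D$ embeds (as a not necessarily induced subdigraph) into $D^*[A]$.
   Context: $\diamondsuit^+$ is the statement that there are countable families $\mathcal S_\beta\subseteq\mathcal P(\beta)$, $\beta<\omega_1$, such that for every $X\subseteq\omega_1$ there is a club $C\subseteq\omega_1$ with $X\cap\beta\in\mathcal S_\beta$ and $C\cap\beta\in\mathcal S_\beta$ for all $\beta\in C$. The half graph $H_{\omega,\omega}$ has vertex set $\omega\times 2$, and $(k,i)(\ell,j)$ is an edge iff $k\leq\ell<\omega$, $i=0$, $j=1$. An orientation of an undirected graph $G$ is a digraph on the same vertex set containing, for each edge $uv$ of $G$, exactly one of the arcs $uv$, $vu$, and no other arcs. $\chi$ is the chromatic number. *)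

theory Defs
  imports Main "HOL-Library.Countable_Set"
begin

text \<open>W is a well-order of the whole type 'w of order type omega_1:
  uncountable, with every proper initial segment countable.
  The ordinal beta < omega_1 corresponds to the set underS W beta of its predecessors.\<close>

definition is_omega1 :: "'w rel \<Rightarrow> bool" where
  "is_omega1 W \<longleftrightarrow> well_order_on UNIV W \<and> \<not> countable (UNIV :: 'w set)
     \<and> (\<forall>\<beta>. countable (underS W \<beta>))"

definition lt :: "'w rel \<Rightarrow> 'w \<Rightarrow> 'w \<Rightarrow> bool" where
  "lt W \<alpha> \<beta> \<longleftrightarrow> (\<alpha>, \<beta>) \<in> W \<and> \<alpha> \<noteq> \<beta>"

definition club :: "'w rel \<Rightarrow> 'w set \<Rightarrow> bool" where
  "club W C \<longleftrightarrow>
     (\<forall>\<alpha>. \<exists>\<gamma>\<in>C. lt W \<alpha> \<gamma>) \<and>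
     (\<forall>\<beta>. (\<exists>\<alpha>. lt W \<alpha> \<beta>) \<and> (\<forall>\<alpha>. lt W \<alpha> \<beta> \<longrightarrow> (\<exists>\<gamma>\<in>C. lt W \<alpha> \<gamma> \<and> lt W \<gamma> \<beta>))
        \<longrightarrow> \<beta> \<in> C)"

definition diamond_plus :: "'w rel \<Rightarrow> bool" where
  "diamond_plus W \<longleftrightarrow>
     (\<exists>S :: 'w \<Rightarrow> 'w set set.
        (\<forall>\<beta>. countable (S \<beta>) \<and> S \<beta> \<subseteq> Pow (underS W \<beta>)) \<and>
        (\<forall>X :: 'w set. \<exists>C. club W C \<and>
            (\<forall>\<beta>\<in>C. X \<inter> underS W \<beta> \<in> S \<beta> \<and> C \<inter> underS W \<beta> \<in> S \<beta>)))"

definition graph :: "'a set \<Rightarrow> ('a \<Rightarrow> 'a \<Rightarrow> bool) \<Rightarrow> bool" where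
  "graph V E \<longleftrightarrow> (\<forall>u v. E u v \<longrightarrow> u \<in> V \<and> v \<in> V \<and> E v u \<and> u \<noteq> v)"

definition proper_colouring :: "('a \<Rightarrow> 'a \<Rightarrow> bool) \<Rightarrow> 'a set \<Rightarrow> ('a \<Rightarrow> 'c) \<Rightarrow> 'c set \<Rightarrow> bool" where
  "proper_colouring E A c K \<longleftrightarrow> c ` A \<subseteq> K \<and> (\<forall>u\<in>A. \<forall>v\<in>A. E u v \<longrightarrow> c u \<noteq> c v)"

text \<open>chi(G[A]) = |Omega|: G[A] is colourable with |Omega| colours and with no
  smaller cardinal number of colours (colour sets taken inside Omega's type, which
  contains sets of all cardinalities up to |Omega|).\<close>

definition chromatic_eq :: "('a \<Rightarrow> 'a \<Rightarrow> bool) \<Rightarrow> 'a set \<Rightarrow> 'c set \<Rightarrow> bool" where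
  "chromatic_eq E A \<Omega> \<longleftrightarrow>
     (\<exists>c. proper_colouring E A c \<Omega>) \<and>
     (\<forall>K. K \<subseteq> \<Omega> \<and> (card_of K, card_of \<Omega>) \<in> ordLess \<longrightarrow> \<not> (\<exists>c. proper_colouring E A c K))"

definition orientation :: "('a \<Rightarrow> 'a \<Rightarrow> bool) \<Rightarrow> 'a rel \<Rightarrow> bool" where
  "orientation E D \<longleftrightarrow>
     (\<forall>u v. (u, v) \<in> D \<longrightarrow> E u v) \<and>
     (\<forall>u v. E u v \<longrightarrow> ((u, v) \<in> D \<longleftrightarrow> (v, u) \<notin> D))"

definition half_V :: "(nat \<times> nat) set" where
  "half_V = UNIV \<times> {0, 1}"

definition half_E :: "nat \<times> nat \<Rightarrow> nat \<times> nat \<Rightarrow> bool" where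
  "half_E x y \<longleftrightarrow>
     (\<lambda>(k, i) (l, j). k \<le> l \<and> i = 0 \<and> j = 1) x y \<or>
     (\<lambda>(k, i) (l, j). k \<le> l \<and> i = 0 \<and> j = 1) y x"

definition embeds_into :: "'b set \<Rightarrow> 'b rel \<Rightarrow> 'a rel \<Rightarrow> 'a set \<Rightarrow> bool" where
  "embeds_into VD D D' A \<longleftrightarrow>
     (\<exists>f. inj_on f VD \<and> f ` VD \<subseteq> A \<and> (\<forall>(x, y)\<in>D. (f x, f y) \<in> D'))"

end

theory Submission
  imports Defs "HOL-Library.Disjoint_Sets" "HOL-Algebra.Free_Abelian_Groups"
begin

text \<open>Identify the vertex set with \<open>\<omega>\<^sub>1\<close> and let \<open>N y\<close> be the set of neighbours below \<open>y\<close>. The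
  orientation is given by sets \<open>T y\<close>, the edge \<open>xy\<close> with \<open>x < y\<close> pointing upwards iff \<open>x \<in> T y\<close>.
  A pattern \<open>(F, P)\<close> with \<open>F\<close> finite and \<open>P \<subseteq> F\<close> is realised at \<open>y\<close> if \<open>F \<subseteq> N y\<close> and \<open>T y \<inter> F = P\<close>.
  The guesses \<open>S \<delta>\<close> are read as countable families of sets of patterns. If such a set \<open>B \<in> S \<delta>\<close> with
  \<open>\<delta> \<le> y\<close> has patterns with \<open>F \<subseteq> N y\<close> avoiding any given finite set, one of them is realised at \<open>y\<close>;
  as there are only countably many such \<open>B\<close>, a suitable \<open>T y\<close> exists.

  For uncountably chromatic \<open>A\<close>, call a pattern rare if it is realised at only countably many
  \<open>y \<in> A\<close>.
  The set of rare patterns is guessed on a club; pass to \<open>\<delta>\<close> so closed that rare patterns below \<open>\<delta>\<close>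
  are realised only below \<open>\<delta>\<close>. As \<open>A\<close> is not countably colourable, some such \<open>\<delta>\<close> and some \<open>y \<in> A\<close>
  with \<open>y \<ge> \<delta>\<close> have \<open>N y \<inter> A \<inter> \<delta>\<close> infinite. No rare pattern below \<open>\<delta>\<close> is realised at \<open>y\<close>, so by the
  choice of \<open>T y\<close> some finite set meets \<open>F\<close> for all rare \<open>(F, P)\<close> with \<open>F \<subseteq> N y \<inter> \<delta>\<close>. Off that
  finite set, every pattern on \<open>N y \<inter> A \<inter> \<delta>\<close> is realised at uncountably many elements of \<open>A\<close>, which yields
  all orientations of the half graph.\<close>

section \<open>Simultaneous selection\<close>

lemma disjoint_finite_selection:
  fixes supp :: "'i \<Rightarrow> 'a set" and Q :: "nat \<Rightarrow> 'i set"
  assumes finite_supp: "\<And>n i. i \<in> Q n \<Longrightarrow> finite (supp i)"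
    and avoiding: "\<And>n Z. finite Z \<Longrightarrow> \<exists>i\<in>Q n. supp i \<inter> Z = {}"
  obtains f where "\<And>n. f n \<in> Q n" and "disjoint_family (\<lambda>n. supp (f n))"
proof -
  have "\<exists>f. \<forall>n. f n \<in> Q n \<and> supp (f n) \<inter> (\<Union>m<n. supp (f m)) = {}"
  proof (rule dependent_wellorder_choice)
    fix n :: nat and f :: "nat \<Rightarrow> 'i"
    assume "\<And>m. m < n \<Longrightarrow> f m \<in> Q m \<and> supp (f m) \<inter> (\<Union>k<m. supp (f k)) = {}"
    then have "finite (\<Union>m<n. supp (f m))"
      using finite_supp by blast
    then show "\<exists>i. i \<in> Q n \<and> supp i \<inter> (\<Union>m<n. supp (f m)) = {}"
      using avoiding by blast
  qed simp
  then obtain f where f: "\<And>n. f n \<in> Q n" "\<And>n. supp (f n) \<inter> (\<Union>m<n. supp (f m)) = {}"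
    by blast
  have "supp (f m) \<inter> supp (f n) = {}" if "m \<noteq> n" for m n
    using that f(2)[of m] f(2)[of n] by (cases m n rule: linorder_cases) auto
  then show ?thesis
    using that[of f] f(1) by (simp add: disjoint_family_on_def)
qed

lemma inj_selection_from_infinite_sets:
  fixes U :: "nat \<Rightarrow> 'a set"
  assumes "\<And>n. infinite (U n)"
  obtains y where "inj y" and "\<And>n. y n \<in> U n"
proof -
  have "\<exists>z\<in>U n. {z} \<inter> Z = {}" if "finite Z" for n Z
    using Diff_infinite_finite[OF that assms[of n]] infinite_imp_nonempty by blast
  then obtain y where "\<And>n. y n \<in> U n" and disjoint: "disjoint_family (\<lambda>n. {y n})"
    by (rule disjoint_finite_selection[of U "\<lambda>z. {z}", rotated]) auto
  moreover have "inj y"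
    using disjoint by (simp add: disjoint_family_on_def inj_def) metis
  ultimately show ?thesis
    using that by blast
qed

section \<open>Patterns\<close>

text \<open>\<open>F\<close> has to be nonempty because patterns will be coded by ordinals, and no code lies below
  the least ordinal, whereas the empty set does.\<close>

definition patterns :: "('a set \<times> 'a set) set" where
  "patterns = {(F, P). finite F \<and> F \<noteq> {} \<and> P \<subseteq> F}"

definition realised_patterns :: "'a set \<Rightarrow> 'a set \<Rightarrow> ('a set \<times> 'a set) set" where
  "realised_patterns N T = {(F, P). F \<subseteq> N \<and> T \<inter> F = P}"

definition finitely_blocked :: "'a set \<Rightarrow> ('a set \<times> 'a set) set \<Rightarrow> bool" where
  "finitely_blocked N B \<longleftrightarrow> (\<exists>Z. finite Z \<and> (\<forall>p\<in>B. fst p \<subseteq> N \<longrightarrow> fst p \<inter> Z \<noteq> {}))"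

lemma finite_patterns_on:
  assumes "finite F"
  shows "finite {p \<in> patterns. fst p = F}"
proof -
  have "{p \<in> patterns. fst p = F} \<subseteq> {F} \<times> Pow F"
    by (auto simp: patterns_def)
  then show ?thesis
    by (rule finite_subset) (simp add: assms)
qed

lemma patterns_lepoll:
  assumes "infinite (UNIV :: 'a set)"
  shows "(patterns :: ('a set \<times> 'a set) set) \<lesssim> (UNIV :: 'a set)"
proof -
  have "(patterns :: ('a set \<times> 'a set) set) \<subseteq> Fpow UNIV \<times> Fpow UNIV"
    by (auto simp: patterns_def Fpow_def intro: finite_subset)
  then have "(patterns :: ('a set \<times> 'a set) set) \<lesssim> Fpow (UNIV :: 'a set) \<times> Fpow (UNIV :: 'a set)"
    by (rule subset_imp_lepoll)
  also have "\<dots> \<approx> (UNIV :: 'a set) \<times> (UNIV :: 'a set)"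
    using eqpoll_Fpow[OF assms] by (intro times_eqpoll_cong)
  also have "\<dots> \<approx> (UNIV :: 'a set)"
    using card_of_Times_same_infinite[OF assms] by (simp add: eqpoll_iff_card_of_ordIso)
  finally show ?thesis .
qed

text \<open>Patterns with pairwise disjoint first components can be realised simultaneously.\<close>

lemma ex_set_realising_unblocked_sequence:
  fixes B :: "nat \<Rightarrow> ('a set \<times> 'a set) set"
  assumes patterns: "\<And>n. B n \<subseteq> patterns" and unblocked: "\<And>n. \<not> finitely_blocked N (B n)"
  shows "\<exists>T. \<forall>n. B n \<inter> realised_patterns N T \<noteq> {}"
proof -
  define Q where "Q n = {q \<in> B n. fst q \<subseteq> N}" for n
  obtain p where p_in: "\<And>n. p n \<in> Q n" and disjoint: "disjoint_family (\<lambda>n. fst (p n))"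
  proof (rule disjoint_finite_selection[of Q fst])
    show "finite (fst q)" if "q \<in> Q n" for n q
      using that patterns[of n] by (fastforce simp: Q_def patterns_def)
    show "\<exists>q\<in>Q n. fst q \<inter> Z = {}" if "finite Z" for n Z
      using that unblocked[of n] unfolding Q_def finitely_blocked_def by blast
  qed blast
  have snd_subset: "snd (p n) \<subseteq> fst (p n)" for n
    using p_in[of n] patterns[of n] by (fastforce simp: Q_def patterns_def)
  define T where "T = (\<Union>n. snd (p n))"
  have "p n \<in> realised_patterns N T" for n
  proof -
    have "m = n" if "x \<in> snd (p m)" "x \<in> fst (p n)" for m x
      using disjoint_family_onD[OF disjoint, of m n] snd_subset[of m] that by blast
    then have "T \<inter> fst (p n) = snd (p n)"
      unfolding T_def using snd_subset[of n] by auto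
    then show ?thesis
      using p_in[of n] by (simp add: Q_def realised_patterns_def case_prod_beta)
  qed
  moreover have "p n \<in> B n" for n
    using p_in[of n] by (simp add: Q_def)
  ultimately show ?thesis
    by blast
qed

lemma ex_set_realising_unblocked:
  assumes "countable \<B>" and patterns: "\<And>B. B \<in> \<B> \<Longrightarrow> B \<subseteq> patterns"
  shows "\<exists>T. \<forall>B\<in>\<B>. \<not> finitely_blocked N B \<longrightarrow> B \<inter> realised_patterns N T \<noteq> {}"
proof -
  define \<H> where "\<H> = {B \<in> \<B>. \<not> finitely_blocked N B}"
  have "\<exists>T. \<forall>B\<in>\<H>. B \<inter> realised_patterns N T \<noteq> {}"
  proof (cases "\<H> = {}")
    case False
    have "countable \<H>"
      using \<open>countable \<B>\<close> by (simp add: \<H>_def)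
    then have range: "range (from_nat_into \<H>) = \<H>"
      by (rule range_from_nat_into[OF False])
    have "from_nat_into \<H> n \<subseteq> patterns" "\<not> finitely_blocked N (from_nat_into \<H> n)" for n
      using from_nat_into[OF False, of n] patterns by (auto simp: \<H>_def)
    then obtain T where "\<forall>n. from_nat_into \<H> n \<inter> realised_patterns N T \<noteq> {}"
      using ex_set_realising_unblocked_sequence[of "from_nat_into \<H>"] by blast
    then have "\<forall>B\<in>range (from_nat_into \<H>). B \<inter> realised_patterns N T \<noteq> {}"
      by simp
    then show ?thesis
      unfolding range by blast
  qed simp
  then show ?thesis
    by (auto simp: \<H>_def)
qed

section \<open>Countable colourability\<close>

definition countably_colourable :: "('a \<Rightarrow> 'a \<Rightarrow> bool) \<Rightarrow> 'a set \<Rightarrow> bool" where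
  "countably_colourable E A \<longleftrightarrow> (\<exists>col :: 'a \<Rightarrow> nat. proper_colouring E A col UNIV)"

lemma countably_colourable_mono:
  assumes "countably_colourable E A" and "\<And>x y. x \<in> A \<Longrightarrow> y \<in> A \<Longrightarrow> E' x y \<Longrightarrow> E x y"
  shows "countably_colourable E' A"
proof -
  obtain col :: "'a \<Rightarrow> nat" where "proper_colouring E A col UNIV"
    using assms(1) unfolding countably_colourable_def by blast
  then have "proper_colouring E' A col UNIV"
    using assms(2) unfolding proper_colouring_def by blast
  then show ?thesis
    unfolding countably_colourable_def by blast
qed

lemma countably_colourable_disj:
  assumes "countably_colourable E A" and "countably_colourable E' A"
  shows "countably_colourable (\<lambda>x y. E x y \<or> E' x y) A"
proof -
  obtain col col' :: "'a \<Rightarrow> nat" where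
    "proper_colouring E A col UNIV" "proper_colouring E' A col' UNIV"
    using assms unfolding countably_colourable_def by blast
  then have "proper_colouring (\<lambda>x y. E x y \<or> E' x y) A (\<lambda>x. to_nat (col x, col' x)) UNIV"
    by (auto simp: proper_colouring_def)
  then show ?thesis
    unfolding countably_colourable_def by blast
qed

lemma countably_colourable_same_fibre:
  assumes "\<And>b. countable {x. f x = b}"
  shows "countably_colourable (\<lambda>x y. x \<noteq> y \<and> f x = f y) A"
proof -
  have "to_nat_on {z. f z = f x} x \<noteq> to_nat_on {z. f z = f y} y" if "x \<noteq> y" "f x = f y" for x y
    using that assms by simp
  then have "proper_colouring (\<lambda>x y. x \<noteq> y \<and> f x = f y) A (\<lambda>x. to_nat_on {z. f z = f x} x) UNIV"
    by (simp add: proper_colouring_def)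
  then show ?thesis
    unfolding countably_colourable_def by blast
qed

lemma countably_colourable_wf_finite_predecessors:
  assumes "wf R" and finite_pred: "\<And>y. finite {x. (x, y) \<in> R}"
  shows "countably_colourable (\<lambda>x y. (x, y) \<in> R \<or> (y, x) \<in> R) A"
proof -
  have "\<exists>col :: 'a \<Rightarrow> nat. \<forall>y. col y \<notin> col ` {x. (x, y) \<in> R}"
  proof (rule dependent_wf_choice[OF \<open>wf R\<close>])
    fix col col' :: "'a \<Rightarrow> nat" and y n
    assume "\<And>x. (x, y) \<in> R \<Longrightarrow> col x = col' x"
    then show "(n \<notin> col ` {x. (x, y) \<in> R}) = (n \<notin> col' ` {x. (x, y) \<in> R})"
      by auto
  next
    fix col :: "'a \<Rightarrow> nat" and y
    show "\<exists>n. n \<notin> col ` {x. (x, y) \<in> R}"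
      using finite_pred[of y] by (intro ex_new_if_finite) auto
  qed
  then obtain col :: "'a \<Rightarrow> nat" where "\<And>y. col y \<notin> col ` {x. (x, y) \<in> R}"
    by blast
  then have "col x \<noteq> col y" if "(x, y) \<in> R" for x y
    using that by (metis imageI mem_Collect_eq)
  then have "proper_colouring (\<lambda>x y. (x, y) \<in> R \<or> (y, x) \<in> R) A col UNIV"
    unfolding proper_colouring_def by (metis subset_UNIV)
  then show ?thesis
    unfolding countably_colourable_def by blast
qed

lemma countably_colourable_image:
  assumes "inj g" and "countably_colourable (\<lambda>a b. E (g a) (g b)) A"
  shows "countably_colourable E (g ` A)"
proof -
  obtain col :: "'a \<Rightarrow> nat" where "proper_colouring (\<lambda>a b. E (g a) (g b)) A col UNIV"
    using assms(2) unfolding countably_colourable_def by blast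
  then have "proper_colouring E (g ` A) (col \<circ> inv_into UNIV g) UNIV"
    using \<open>inj g\<close> by (auto simp: proper_colouring_def)
  then show ?thesis
    unfolding countably_colourable_def by blast
qed

lemma chromatic_eq_not_colourable_with_fewer:
  fixes \<Omega> :: "'c set" and K :: "'d set"
  assumes chi: "chromatic_eq E A \<Omega>" and "(card_of K, card_of \<Omega>) \<in> ordLess"
  shows "\<not> proper_colouring E A col K"
proof
  assume col: "proper_colouring E A col K"
  obtain i where i: "inj_on i K" "i ` K \<subseteq> \<Omega>"
    using ordLess_imp_ordLeq[OF assms(2)] unfolding card_of_ordLeq[symmetric] by blast
  have "(card_of (i ` K), card_of \<Omega>) \<in> ordLess"
    using card_of_image assms(2) by (rule ordLeq_ordLess_trans)
  moreover have "proper_colouring E A (i \<circ> col) (i ` K)"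
    using col i(1) unfolding proper_colouring_def by (simp add: image_subset_iff inj_on_eq_iff)
  ultimately show False
    using chi i(2) unfolding chromatic_eq_def by blast
qed

lemma chromatic_eq_not_countably_colourable:
  assumes "chromatic_eq E A \<Omega>" and "uncountable \<Omega>"
  shows "\<not> countably_colourable E A"
proof -
  have "(card_of (UNIV :: nat set), card_of \<Omega>) \<in> ordLess"
    using assms(2) unfolding card_of_ordLess[symmetric] countable_def by simp
  then show ?thesis
    using chromatic_eq_not_colourable_with_fewer[OF assms(1)]
    unfolding countably_colourable_def by blast
qed

section \<open>Orientations\<close>

definition half_graph_universal :: "'a rel \<Rightarrow> 'a set \<Rightarrow> bool" where
  "half_graph_universal D' A \<longleftrightarrow> (\<forall>D. orientation half_E D \<longrightarrow> embeds_into half_V D D' A)"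

lemma half_graph_orientation_embeds:
  fixes x y :: "nat \<Rightarrow> 'a"
  assumes D: "orientation half_E D" and D': "orientation E D'"
    and "inj x" "inj y" "range x \<subseteq> A" "range y \<subseteq> A" and distinct: "\<And>k l. x k \<noteq> y l"
    and edge: "\<And>k l. k \<le> l \<Longrightarrow> E (x k) (y l)"
    and arc: "\<And>k l. k \<le> l \<Longrightarrow> (x k, y l) \<in> D' \<longleftrightarrow> ((k, 0), (l, 1)) \<in> D"
  shows "embeds_into half_V D D' A"
proof -
  define f where "f = (\<lambda>(k, i :: nat). if i = 0 then x k else y k)"
  have "inj_on f half_V"
    using \<open>inj x\<close> \<open>inj y\<close> distinct distinct[symmetric] by (auto simp: inj_on_def f_def half_V_def)
  moreover have "f ` half_V \<subseteq> A"
    using \<open>range x \<subseteq> A\<close> \<open>range y \<subseteq> A\<close> by (auto simp: f_def image_subset_iff)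
  moreover have "(f u, f v) \<in> D'" if uv: "(u, v) \<in> D" for u v
  proof -
    have "half_E u v"
      using D uv unfolding orientation_def by blast
    then consider k l where "k \<le> l" "u = (k, 0)" "v = (l, 1)"
      | k l where "k \<le> l" "u = (l, 1)" "v = (k, 0)"
      by (cases u; cases v) (auto simp: half_E_def)
    then show ?thesis
    proof cases
      case 1
      then show ?thesis
        using arc uv by (simp add: f_def)
    next
      case 2
      then have "((k, 0), (l, 1)) \<notin> D"
        using D uv \<open>half_E u v\<close> unfolding orientation_def by blast
      then have "(y l, x k) \<in> D'"
        using D' edge[OF 2(1)] arc[OF 2(1)] unfolding orientation_def by blast
      then show ?thesis
        using 2 by (simp add: f_def)
    qed
  qed
  ultimately show ?thesis
    unfolding embeds_into_def by blast
qed

lemma orientation_map_prod: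
  assumes "inj g" and range: "\<And>u v. E u v \<Longrightarrow> u \<in> range g \<and> v \<in> range g"
    and D: "orientation (\<lambda>a b. E (g a) (g b)) D"
  shows "orientation E (map_prod g g ` D)"
  unfolding orientation_def
proof (intro conjI allI impI)
  fix u v
  show "E u v" if "(u, v) \<in> map_prod g g ` D"
    using D that by (auto simp: orientation_def)
  have "(g a, g b) \<in> map_prod g g ` D \<longleftrightarrow> (a, b) \<in> D" for a b
    using \<open>inj g\<close> by (auto simp: inj_eq)
  then show "(u, v) \<in> map_prod g g ` D \<longleftrightarrow> (v, u) \<notin> map_prod g g ` D" if "E u v"
    using D that range[OF that] unfolding orientation_def by (elim conjE rangeE) metis
qed

lemma half_graph_universal_map_prod:
  assumes "inj g" and universal: "half_graph_universal D' A"
  shows "half_graph_universal (map_prod g g ` D') (g ` A)"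
  unfolding half_graph_universal_def
proof (intro allI impI)
  fix D assume "orientation half_E D"
  then obtain f where f: "inj_on f half_V" "f ` half_V \<subseteq> A" "\<forall>(u, v)\<in>D. (f u, f v) \<in> D'"
    using universal unfolding half_graph_universal_def embeds_into_def by blast
  have "inj_on (g \<circ> f) half_V"
    using f(1) \<open>inj g\<close> by (meson comp_inj_on inj_on_subset subset_UNIV)
  then show "embeds_into half_V D (map_prod g g ` D') (g ` A)"
    unfolding embeds_into_def using f(2,3) by (intro exI[of _ "g \<circ> f"]) fastforce
qed

section \<open>Well-orders\<close>

locale wellordered =
  fixes W :: "'w rel"
  assumes well_order: "well_order_on UNIV W"
begin

abbreviation le_W (infix "\<le>\<^sub>W" 50) where "x \<le>\<^sub>W y \<equiv> (x, y) \<in> W"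

abbreviation less_W (infix "<\<^sub>W" 50) where "x <\<^sub>W y \<equiv> lt W x y"

sublocale wo: wellorder "\<lambda>x y. x \<le>\<^sub>W y" "lt W"
proof
  have W: "refl W" "trans W" "antisym W" "total W" "wf (W - Id)"
    using well_order
    by (auto simp: well_order_on_def linear_order_on_def partial_order_on_def preorder_on_def)
  fix x y z P
  show "x \<le>\<^sub>W x"
    using W(1) by (rule reflD)
  show "x \<le>\<^sub>W z" if "x \<le>\<^sub>W y" "y \<le>\<^sub>W z"
    using W(2) that by (rule transD)
  show "x = y" if "x \<le>\<^sub>W y" "y \<le>\<^sub>W x"
    using W(3) that by (rule antisymD)
  show "x \<le>\<^sub>W y \<or> y \<le>\<^sub>W x"
    using W(1,4) by (cases "x = y") (auto simp: refl_on_def total_on_def)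
  show "x <\<^sub>W y \<longleftrightarrow> x \<le>\<^sub>W y \<and> \<not> y \<le>\<^sub>W x"
    using W(1,3) by (auto simp: lt_def refl_on_def dest: antisymD)
  show "P x" if "\<And>x. (\<And>y. y <\<^sub>W x \<Longrightarrow> P y) \<Longrightarrow> P x"
    using W(5) by (rule wf_induct_rule) (use that in \<open>auto simp: lt_def\<close>)
qed

lemma mem_underS [simp]: "x \<in> underS W y \<longleftrightarrow> x <\<^sub>W y"
  by (auto simp: underS_def lt_def)

lemma mem_under [simp]: "x \<in> under W y \<longleftrightarrow> x \<le>\<^sub>W y"
  by (simp add: under_def)

lemma nonempty_Fpow_underS:
  "Fpow (underS W d) - {{}} = (\<Union>x\<in>underS W d. Fpow (under W x) - {{}})"
proof (intro equalityI subsetI)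
  fix F assume F: "F \<in> Fpow (underS W d) - {{}}"
  obtain x where "x \<in> F" "\<forall>z\<in>F. x \<le>\<^sub>W z \<longrightarrow> x = z"
    using wo.finite_has_maximal[of F] F by (auto simp: Fpow_def)
  moreover from this have "F \<subseteq> under W x"
    using wo.linear by fastforce
  ultimately show "F \<in> (\<Union>x\<in>underS W d. Fpow (under W x) - {{}})"
    using F by (auto simp: Fpow_def)
next
  fix F assume "F \<in> (\<Union>x\<in>underS W d. Fpow (under W x) - {{}})"
  then show "F \<in> Fpow (underS W d) - {{}}"
    using wo.le_less_trans by (fastforce simp: Fpow_def)
qed

lemma club_unbounded:
  assumes "club W C"
  obtains c where "c \<in> C" "a <\<^sub>W c"
  using assms unfolding club_def by blast

lemma club_closed:
  assumes "club W C" "z <\<^sub>W b" "\<And>a. a <\<^sub>W b \<Longrightarrow> \<exists>c\<in>C. a <\<^sub>W c \<and> c <\<^sub>W b"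
  shows "b \<in> C"
  using assms unfolding club_def by blast

lemma club_greatest_below:
  assumes club_C: "club W C" and "c \<in> C" "c \<le>\<^sub>W y"
  obtains d where "d \<in> C" "d \<le>\<^sub>W y" "\<And>b. b \<in> C \<Longrightarrow> b \<le>\<^sub>W y \<Longrightarrow> b \<le>\<^sub>W d"
proof -
  define ub where "ub d \<longleftrightarrow> (\<forall>b\<in>C. b \<le>\<^sub>W y \<longrightarrow> b \<le>\<^sub>W d)" for d
  define d where "d = wo.Least ub"
  have "ub y"
    by (simp add: ub_def)
  then have "ub d" and "d \<le>\<^sub>W y"
    unfolding d_def by (rule wo.LeastI, rule wo.Least_le)
  have "d \<in> C"
  proof (rule ccontr)
    assume "d \<notin> C"
    then have below: "b <\<^sub>W d" if "b \<in> C" "b \<le>\<^sub>W y" for b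
      using that \<open>ub d\<close> wo.le_less unfolding ub_def by blast
    have "\<exists>b\<in>C. a <\<^sub>W b \<and> b <\<^sub>W d" if "a <\<^sub>W d" for a
    proof -
      have "\<not> ub a"
        using that unfolding d_def by (rule wo.not_less_Least)
      then show ?thesis
        using below wo.not_le unfolding ub_def by blast
    qed
    with club_C below[OF assms(2,3)] have "d \<in> C"
      by (rule club_closed)
    then show False
      using \<open>d \<notin> C\<close> by blast
  qed
  then show ?thesis
    using that \<open>ub d\<close> \<open>d \<le>\<^sub>W y\<close> by (simp add: ub_def)
qed

definition next_in :: "'w set \<Rightarrow> 'w \<Rightarrow> 'w" where
  "next_in C x = wo.Least (\<lambda>c. c \<in> C \<and> x <\<^sub>W c)"

lemma next_in:
  assumes "club W C"
  shows "next_in C x \<in> C" and "x <\<^sub>W next_in C x"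
proof -
  obtain c where "c \<in> C \<and> x <\<^sub>W c"
    using club_unbounded[OF assms] by blast
  then have "next_in C x \<in> C \<and> x <\<^sub>W next_in C x"
    unfolding next_in_def by (rule wo.LeastI)
  then show "next_in C x \<in> C" and "x <\<^sub>W next_in C x"
    by blast+
qed

lemma next_in_le: "c \<in> C \<Longrightarrow> x <\<^sub>W c \<Longrightarrow> next_in C x \<le>\<^sub>W c"
  unfolding next_in_def by (simp add: wo.Least_le)

lemma finite_neighbours_in_earlier_blocks:
  assumes club_C: "club W C"
    and finite_below: "\<And>d. d \<in> C \<Longrightarrow> d \<le>\<^sub>W y \<Longrightarrow> finite {x \<in> A. x <\<^sub>W d \<and> E x y}"
  shows "finite {x \<in> A. next_in C x <\<^sub>W next_in C y \<and> E x y}"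
proof -
  have next_le: "next_in C x \<le>\<^sub>W y" if "next_in C x <\<^sub>W next_in C y" for x
    using that next_in_le[OF next_in(1)[OF club_C], of y x] wo.not_less by blast
  show ?thesis
  proof (cases "\<exists>c\<in>C. c \<le>\<^sub>W y")
    case True
    then obtain d where d: "d \<in> C" "d \<le>\<^sub>W y" "\<And>b. b \<in> C \<Longrightarrow> b \<le>\<^sub>W y \<Longrightarrow> b \<le>\<^sub>W d"
      using club_greatest_below[OF club_C] by blast
    have "x <\<^sub>W d" if "next_in C x <\<^sub>W next_in C y" for x
      using next_in[OF club_C, of x] d(3) next_le[OF that] wo.less_le_trans by blast
    then show ?thesis
      by (intro finite_subset[OF _ finite_below[OF d(1,2)]]) blast
  next
    case False
    then have "{x \<in> A. next_in C x <\<^sub>W next_in C y \<and> E x y} = {}"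
      using next_le next_in(1)[OF club_C] by blast
    then show ?thesis
      by (metis finite.emptyI)
  qed
qed

section \<open>Upward orientations and rare patterns\<close>

definition lower_neighbours :: "('w \<Rightarrow> 'w \<Rightarrow> bool) \<Rightarrow> 'w \<Rightarrow> 'w set" where
  "lower_neighbours E y = {x. x <\<^sub>W y \<and> E x y}"

definition upward_orientation :: "('w \<Rightarrow> 'w \<Rightarrow> bool) \<Rightarrow> ('w \<Rightarrow> 'w set) \<Rightarrow> 'w rel" where
  "upward_orientation E T = {(u, v). E u v \<and> (if u <\<^sub>W v then u \<in> T v else v \<notin> T u)}"

definition realisers ::
    "('w \<Rightarrow> 'w \<Rightarrow> bool) \<Rightarrow> ('w \<Rightarrow> 'w set) \<Rightarrow> 'w set \<Rightarrow> 'w set \<times> 'w set \<Rightarrow> 'w set" where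
  "realisers E T A p = {y \<in> A. p \<in> realised_patterns (lower_neighbours E y) (T y)}"

definition rare_patterns ::
    "('w \<Rightarrow> 'w \<Rightarrow> bool) \<Rightarrow> ('w \<Rightarrow> 'w set) \<Rightarrow> 'w set \<Rightarrow> ('w set \<times> 'w set) set" where
  "rare_patterns E T A = {p \<in> patterns. countable (realisers E T A p)}"

lemma orientation_upward_orientation:
  assumes "graph UNIV E"
  shows "orientation E (upward_orientation E T)"
proof -
  have "(u, v) \<in> upward_orientation E T \<longleftrightarrow> (v, u) \<notin> upward_orientation E T" if "E u v" for u v
  proof -
    have "E v u" "u \<noteq> v"
      using assms that by (auto simp: graph_def)
    then show ?thesis
      using that wo.less_linear[of u v] wo.less_not_sym[of u v]
      by (auto simp: upward_orientation_def)
  qed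
  then show ?thesis
    unfolding orientation_def by (simp add: upward_orientation_def)
qed

lemma realisersD:
  assumes "y \<in> realisers E T A (F, P)" and "x \<in> F"
  shows "E x y" and "(x, y) \<in> upward_orientation E T \<longleftrightarrow> x \<in> P"
proof -
  have "F \<subseteq> lower_neighbours E y" "T y \<inter> F = P"
    using assms(1) by (auto simp: realisers_def realised_patterns_def)
  then show "E x y" and "(x, y) \<in> upward_orientation E T \<longleftrightarrow> x \<in> P"
    using assms(2) by (auto simp: lower_neighbours_def upward_orientation_def)
qed

lemma half_graph_universal_if_no_rare_patterns:
  assumes graph_E: "graph UNIV E" and X: "infinite X" "X \<subseteq> A"
    and no_rare: "\<And>p. p \<in> rare_patterns E T A \<Longrightarrow> \<not> fst p \<subseteq> X"
  shows "half_graph_universal (upward_orientation E T) A"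
  unfolding half_graph_universal_def
proof (intro allI impI)
  fix D assume D: "orientation half_E D"
  obtain x :: "nat \<Rightarrow> 'w" where x: "inj x" "range x \<subseteq> X"
    using X(1) by (meson infinite_countable_subset)
  define F where "F l = x ` {..l}" for l
  define P where "P l = x ` {k. k \<le> l \<and> ((k, 0), (l, 1)) \<in> D}" for l
  define U where "U l = realisers E T A (F l, P l)" for l
  have "uncountable (U l)" for l
    using no_rare[of "(F l, P l)"] x(2)
    by (auto simp: U_def F_def P_def patterns_def rare_patterns_def image_subset_iff)
  then have "infinite (U l - range x)" for l
    using uncountable_minus_countable[of "U l" "range x"] countable_finite by auto
  then obtain y where "inj y" and y: "\<And>l. y l \<in> U l - range x"
    using inj_selection_from_infinite_sets[of "\<lambda>l. U l - range x"] by blast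
  have "range x \<subseteq> A" "range y \<subseteq> A"
    using x(2) X(2) y by (auto simp: U_def realisers_def)
  with D orientation_upward_orientation[OF graph_E] x(1) \<open>inj y\<close>
  show "embeds_into half_V D (upward_orientation E T) A"
  proof (rule half_graph_orientation_embeds)
    show "x k \<noteq> y l" for k l
      using y[of l] by (metis DiffD2 rangeI)
    fix k l :: nat assume "k \<le> l"
    then have x_in_F: "x k \<in> F l"
      by (simp add: F_def)
    have y_realises: "y l \<in> realisers E T A (F l, P l)"
      using y[of l] by (simp add: U_def)
    show "E (x k) (y l)"
      by (rule realisersD(1)[OF y_realises x_in_F])
    have "x k \<in> P l \<longleftrightarrow> ((k, 0), (l, 1)) \<in> D"
      using \<open>k \<le> l\<close> x(1) by (auto simp: P_def inj_def)
    then show "(x k, y l) \<in> upward_orientation E T \<longleftrightarrow> ((k, 0), (l, 1)) \<in> D"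
      by (simp add: realisersD(2)[OF y_realises x_in_F])
  qed
qed

definition guesses_pattern_sets :: "('w \<Rightarrow> ('w set \<times> 'w set) set set) \<Rightarrow> bool" where
  "guesses_pattern_sets S \<longleftrightarrow>
     (\<forall>d. countable (S d) \<and> (\<forall>B\<in>S d. B \<subseteq> patterns)) \<and>
     (\<forall>B\<subseteq>patterns. \<exists>C. club W C \<and> (\<forall>d\<in>C. {p \<in> B. fst p \<subseteq> underS W d} \<in> S d))"

definition meets_guesses ::
    "('w \<Rightarrow> ('w set \<times> 'w set) set set) \<Rightarrow> ('w \<Rightarrow> 'w set) \<Rightarrow> ('w \<Rightarrow> 'w set) \<Rightarrow> bool" where
  "meets_guesses S N T \<longleftrightarrow>
     (\<forall>y d. d \<le>\<^sub>W y \<longrightarrow> (\<forall>B\<in>S d. \<not> finitely_blocked (N y) B \<longrightarrow>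
       B \<inter> realised_patterns (N y) (T y) \<noteq> {}))"

lemma rare_patterns_below_finitely_blocked:
  assumes meets_T: "meets_guesses S (lower_neighbours E) T" and y: "y \<in> A" "d \<le>\<^sub>W y"
    and guessed: "{p \<in> rare_patterns E T A. fst p \<subseteq> underS W d} \<in> S d" (is "?B \<in> _")
    and realisers_below: "\<And>p. p \<in> rare_patterns E T A \<Longrightarrow> fst p \<subseteq> underS W d \<Longrightarrow>
      realisers E T A p \<subseteq> underS W d"
  shows "finitely_blocked (lower_neighbours E y) {p \<in> rare_patterns E T A. fst p \<subseteq> underS W d}"
proof -
  have "y \<notin> underS W d"
    using y(2) wo.not_le by auto
  then have "y \<notin> realisers E T A p" if "p \<in> ?B" for p
    using that realisers_below[of p] by blast
  then have "?B \<inter> realised_patterns (lower_neighbours E y) (T y) = {}"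
    using y(1) unfolding realisers_def by blast
  then show ?thesis
    using meets_T y(2) guessed unfolding meets_guesses_def by blast
qed

end

section \<open>The order type \<open>\<omega>\<^sub>1\<close>\<close>

locale omega1 = wellordered W for W :: "'w rel" +
  assumes uncountable_UNIV: "uncountable (UNIV :: 'w set)"
    and countable_underS: "countable (underS W b)"
begin

lemma countable_under: "countable (under W b)"
proof -
  have "under W b = insert b (underS W b)"
    using wo.le_less by auto
  then show ?thesis
    using countable_underS by simp
qed

lemma ex_closure_point_above:
  assumes "\<And>x. countable (K x)"
  obtains d where "a <\<^sub>W d" and "\<And>x. x <\<^sub>W d \<Longrightarrow> K x \<subseteq> underS W d"
proof -
  define R where "R = (SIGMA x:UNIV. K x \<union> underS W x)"
  define M where "M = R\<^sup>* `` {a}"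
  have M_closed: "K x \<union> underS W x \<subseteq> M" if "x \<in> M" for x
    using that unfolding M_def R_def by (auto intro: rtrancl_into_rtrancl)
  have "R `` Y = (\<Union>x\<in>Y. K x \<union> underS W x)" for Y
    by (auto simp: R_def)
  then have "countable M"
    unfolding M_def using assms countable_underS by (intro countable_rtrancl) auto
  then obtain z where "z \<notin> M"
    using uncountable_UNIV by (metis UNIV_eq_I)
  then obtain d where d: "d \<notin> M" and below: "\<And>x. x <\<^sub>W d \<Longrightarrow> x \<in> M"
    using wo.exists_least_iff[of "\<lambda>x. x \<notin> M"] by blast
  have "M = underS W d"
    using d below M_closed wo.less_linear by (metis UnI2 mem_underS subsetD subsetI subset_antisym)
  then show ?thesis
    using that M_closed unfolding M_def by fastforce
qed

lemma club_closure_points: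
  assumes club_C: "club W C" and countable_K: "\<And>x. countable (K x)"
  shows "club W {d \<in> C. \<forall>x. x <\<^sub>W d \<longrightarrow> K x \<subseteq> underS W d}" (is "club W ?D")
  unfolding club_def
proof (intro conjI allI impI)
  fix a
  have "\<forall>x. \<exists>c\<in>C. x <\<^sub>W c"
    using club_C by (simp add: club_def)
  then obtain nxt where nxt: "\<And>x. nxt x \<in> C" "\<And>x. x <\<^sub>W nxt x"
    by metis
  obtain d where d: "a <\<^sub>W d" "\<And>x. x <\<^sub>W d \<Longrightarrow> insert (nxt x) (K x) \<subseteq> underS W d"
    using ex_closure_point_above[of "\<lambda>x. insert (nxt x) (K x)"] countable_K by auto
  have "d \<in> C"
    using club_closed[OF club_C d(1)] nxt d(2) by fastforce
  then show "\<exists>c\<in>?D. a <\<^sub>W c"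
    using d by blast
next
  fix b
  assume limit: "(\<exists>a. a <\<^sub>W b) \<and> (\<forall>a. a <\<^sub>W b \<longrightarrow> (\<exists>c\<in>?D. a <\<^sub>W c \<and> c <\<^sub>W b))"
  then obtain z where "z <\<^sub>W b"
    by blast
  then have "b \<in> C"
    by (rule club_closed[OF club_C]) (use limit in blast)
  moreover have "K x \<subseteq> underS W b" if x: "x <\<^sub>W b" for x
  proof -
    obtain c where "c \<in> ?D" "x <\<^sub>W c" "c <\<^sub>W b"
      using limit x by blast
    moreover from this have "underS W c \<subseteq> underS W b"
      using wo.less_trans by (auto simp only: mem_underS subset_iff)
    ultimately show ?thesis
      by blast
  qed
  ultimately show "b \<in> ?D"
    by blast
qed

lemma club_closed_under_finite_subsets:
  assumes club_C: "club W C" and countable_K: "\<And>F. finite F \<Longrightarrow> countable (K F)"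
  shows "club W {d \<in> C. \<forall>F\<in>Fpow (underS W d) - {{}}. K F \<subseteq> underS W d}"
proof -
  have "countable (\<Union>F\<in>Fpow (under W x) - {{}}. K F)" for x
    using countable_under countable_K
    by (intro countable_UN countable_Diff countable_Fpow) (auto simp: Fpow_def)
  then have "club W {d \<in> C. \<forall>x. x <\<^sub>W d \<longrightarrow> (\<Union>F\<in>Fpow (under W x) - {{}}. K F) \<subseteq> underS W d}"
    by (rule club_closure_points[OF club_C])
  then show ?thesis
    unfolding nonempty_Fpow_underS ball_UN by (simp add: UN_subset_iff Ball_def)
qed

text \<open>A club cuts \<open>\<omega>\<^sub>1\<close> into countable blocks, so a countable colouring only has to take care of the
  edges between different blocks.\<close>

lemma countably_colourable_if_finite_below_club:
  assumes club_C: "club W C" and graph_E: "graph UNIV E"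
    and finite_below: "\<And>d y. d \<in> C \<Longrightarrow> y \<in> A \<Longrightarrow> d \<le>\<^sub>W y \<Longrightarrow> finite {x \<in> A. x <\<^sub>W d \<and> E x y}"
  shows "countably_colourable E A"
proof -
  define R where "R = {(x, y). x \<in> A \<and> y \<in> A \<and> next_in C x <\<^sub>W next_in C y \<and> E x y}"
  have "wf R"
    by (rule wf_subset[OF wf_inv_image[OF wo.wf, of "next_in C"]]) (auto simp: R_def)
  moreover have "finite {x. (x, y) \<in> R}" for y
  proof (cases "y \<in> A")
    case True
    then show ?thesis
      using finite_neighbours_in_earlier_blocks[OF club_C, of y A E] finite_below
      by (simp add: R_def)
  qed (simp add: R_def)
  ultimately have "countably_colourable (\<lambda>x y. (x, y) \<in> R \<or> (y, x) \<in> R) A"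
    by (rule countably_colourable_wf_finite_predecessors)
  moreover have "countable {x. next_in C x = b}" for b
    by (rule countable_subset[OF _ countable_underS[of b]]) (use next_in(2)[OF club_C] in auto)
  then have "countably_colourable (\<lambda>x y. x \<noteq> y \<and> next_in C x = next_in C y) A"
    by (rule countably_colourable_same_fibre)
  ultimately show ?thesis
  proof (rule countably_colourable_mono[OF countably_colourable_disj])
    fix x y assume "x \<in> A" "y \<in> A" "E x y"
    moreover from this have "E y x" "x \<noteq> y"
      using graph_E by (auto simp: graph_def)
    ultimately show "((x, y) \<in> R \<or> (y, x) \<in> R) \<or> x \<noteq> y \<and> next_in C x = next_in C y"
      using wo.less_linear[of "next_in C x" "next_in C y"] unfolding R_def by blast
  qed
qed

section \<open>Guessing sets of patterns\<close>

lemma club_code_below_iff_support_below: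
  assumes club_C: "club W C" and code: "inj_on code (patterns :: ('w set \<times> 'w set) set)"
  obtains C' where "club W C'" "C' \<subseteq> C"
    and "\<And>d p. d \<in> C' \<Longrightarrow> p \<in> patterns \<Longrightarrow> code p <\<^sub>W d \<longleftrightarrow> fst p \<subseteq> underS W d"
proof -
  define K where "K F = (\<Union>p\<in>{p \<in> patterns. fst p = F \<or> code p \<in> F}. insert (code p) (fst p))" for F
  have "countable (K F)" if "finite F" for F
  proof -
    have "{p \<in> patterns. fst p = F \<or> code p \<in> F} =
        {p \<in> patterns. fst p = F} \<union> (code -` F \<inter> patterns)"
      by blast
    then have "countable {p \<in> patterns. fst p = F \<or> code p \<in> F}"
      using finite_patterns_on[OF that] finite_vimage_IntI[OF that code]
      by (simp add: countable_finite)
    moreover have "countable (insert (code p) (fst p))" if "p \<in> patterns" for p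
      using that by (auto simp: patterns_def countable_finite)
    ultimately show ?thesis
      unfolding K_def by (intro countable_UN) auto
  qed
  then have "club W {d \<in> C. \<forall>F\<in>Fpow (underS W d) - {{}}. K F \<subseteq> underS W d}" (is "club W ?C'")
    by (rule club_closed_under_finite_subsets[OF club_C])
  moreover have "code p <\<^sub>W d \<longleftrightarrow> fst p \<subseteq> underS W d" if d: "d \<in> ?C'" and p: "p \<in> patterns" for d p
  proof
    assume "code p <\<^sub>W d"
    then have "K {code p} \<subseteq> underS W d"
      using d by (simp add: Fpow_def)
    moreover have "fst p \<subseteq> K {code p}"
      using p unfolding K_def by blast
    ultimately show "fst p \<subseteq> underS W d"
      by blast
  next
    assume "fst p \<subseteq> underS W d"
    then have "K (fst p) \<subseteq> underS W d"
      using d p by (auto simp: Fpow_def patterns_def)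
    moreover have "code p \<in> K (fst p)"
      using p unfolding K_def by blast
    ultimately show "code p <\<^sub>W d"
      using mem_underS by blast
  qed
  ultimately show ?thesis
    by (intro that[of ?C']) blast+
qed

lemma diamond_plus_guesses_pattern_sets:
  assumes "diamond_plus W"
  shows "\<exists>S. guesses_pattern_sets S"
proof -
  obtain S :: "'w \<Rightarrow> 'w set set" where countable_S: "\<And>d. countable (S d)"
    and guess: "\<And>X. \<exists>C. club W C \<and> (\<forall>d\<in>C. X \<inter> underS W d \<in> S d)"
    using assms unfolding diamond_plus_def by metis
  have "infinite (UNIV :: 'w set)"
    using uncountable_UNIV countable_finite by blast
  then obtain code :: "'w set \<times> 'w set \<Rightarrow> 'w" where code: "inj_on code patterns"
    using patterns_lepoll unfolding lepoll_def by blast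
  define decode where "decode X = {p \<in> patterns. code p \<in> X}" for X
  have "\<exists>C. club W C \<and> (\<forall>d\<in>C. {p \<in> B. fst p \<subseteq> underS W d} \<in> decode ` S d)"
    if B: "B \<subseteq> patterns" for B
  proof -
    obtain C where club_C: "club W C" and guess_C: "\<And>d. d \<in> C \<Longrightarrow> code ` B \<inter> underS W d \<in> S d"
      using guess by metis
    obtain C' where club_C': "club W C'" and "C' \<subseteq> C"
      and below_iff: "\<And>d p. d \<in> C' \<Longrightarrow> p \<in> patterns \<Longrightarrow> code p <\<^sub>W d \<longleftrightarrow> fst p \<subseteq> underS W d"
      using club_code_below_iff_support_below[OF club_C code] by blast
    have "{p \<in> B. fst p \<subseteq> underS W d} = decode (code ` B \<inter> underS W d)" if d: "d \<in> C'" for d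
    proof -
      have "code p \<in> code ` B \<inter> underS W d \<longleftrightarrow> p \<in> B \<and> fst p \<subseteq> underS W d" if "p \<in> patterns" for p
        using inj_on_image_mem_iff[OF code that B] below_iff[OF d that] by simp
      then show ?thesis
        using B unfolding decode_def by blast
    qed
    moreover have "code ` B \<inter> underS W d \<in> S d" if "d \<in> C'" for d
      using guess_C \<open>C' \<subseteq> C\<close> that by blast
    ultimately show ?thesis
      using club_C' by (intro exI[of _ C']) simp
  qed
  then have "guesses_pattern_sets (\<lambda>d. decode ` S d)"
    using countable_S by (auto simp: guesses_pattern_sets_def decode_def)
  then show ?thesis
    by blast
qed

lemma ex_meets_guesses:
  assumes "guesses_pattern_sets S"
  shows "\<exists>T. meets_guesses S N T"
proof -
  have "\<exists>T. \<forall>B\<in>\<Union>(S ` under W y).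
      \<not> finitely_blocked (N y) B \<longrightarrow> B \<inter> realised_patterns (N y) T \<noteq> {}" for y
  proof (rule ex_set_realising_unblocked)
    show "countable (\<Union>(S ` under W y))"
      using assms countable_under by (intro countable_UN) (auto simp: guesses_pattern_sets_def)
    show "B \<subseteq> patterns" if "B \<in> \<Union>(S ` under W y)" for B
      using assms that unfolding guesses_pattern_sets_def by blast
  qed
  then obtain T where "\<forall>y. \<forall>B\<in>\<Union>(S ` under W y).
      \<not> finitely_blocked (N y) B \<longrightarrow> B \<inter> realised_patterns (N y) (T y) \<noteq> {}"
    by metis
  then have "meets_guesses S N T"
    unfolding meets_guesses_def by auto
  then show ?thesis
    by blast
qed

lemma club_realisers_of_rare_patterns_below:
  assumes club_C: "club W C"
  shows "club W {d \<in> C. \<forall>p\<in>rare_patterns E T A.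
    fst p \<subseteq> underS W d \<longrightarrow> realisers E T A p \<subseteq> underS W d}"
proof -
  let ?R = "rare_patterns E T A"
  define K where "K F = (\<Union>p\<in>{p \<in> ?R. fst p = F}. realisers E T A p)" for F
  have "countable (K F)" if "finite F" for F
  proof -
    have "{p \<in> ?R. fst p = F} \<subseteq> {p \<in> patterns. fst p = F}"
      by (auto simp: rare_patterns_def)
    then have "countable {p \<in> ?R. fst p = F}"
      using finite_patterns_on[OF that] by (meson countable_finite finite_subset)
    then show ?thesis
      unfolding K_def by (rule countable_UN) (simp add: rare_patterns_def)
  qed
  then have "club W {d \<in> C. \<forall>F\<in>Fpow (underS W d) - {{}}. K F \<subseteq> underS W d}"
    by (rule club_closed_under_finite_subsets[OF club_C])
  moreover have "(\<forall>F\<in>Fpow (underS W d) - {{}}. K F \<subseteq> underS W d) \<longleftrightarrow>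
      (\<forall>p\<in>?R. fst p \<subseteq> underS W d \<longrightarrow> realisers E T A p \<subseteq> underS W d)" for d
  proof -
    have "(\<forall>F\<in>\<F>. K F \<subseteq> U) \<longleftrightarrow> (\<forall>p\<in>?R. fst p \<in> \<F> \<longrightarrow> realisers E T A p \<subseteq> U)" for \<F> U
      unfolding K_def UN_subset_iff by blast
    moreover have "fst p \<in> Fpow (underS W d) - {{}} \<longleftrightarrow> fst p \<subseteq> underS W d" if "p \<in> ?R" for p
      using that by (auto simp: Fpow_def rare_patterns_def patterns_def)
    ultimately show ?thesis
      by simp
  qed
  ultimately show ?thesis
    by simp
qed

lemma ex_infinite_set_without_rare_patterns:
  assumes guesses_S: "guesses_pattern_sets S" and meets_T: "meets_guesses S (lower_neighbours E) T"
    and graph_E: "graph UNIV E" and uncolourable: "\<not> countably_colourable E A"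
  obtains X where "infinite X" "X \<subseteq> A" "\<And>p. p \<in> rare_patterns E T A \<Longrightarrow> \<not> fst p \<subseteq> X"
proof -
  have "rare_patterns E T A \<subseteq> patterns"
    by (auto simp: rare_patterns_def)
  then have "\<exists>C. club W C \<and> (\<forall>d\<in>C. {p \<in> rare_patterns E T A. fst p \<subseteq> underS W d} \<in> S d)"
    using guesses_S by (simp add: guesses_pattern_sets_def)
  then obtain C where club_C: "club W C"
    and guessed: "\<And>d. d \<in> C \<Longrightarrow> {p \<in> rare_patterns E T A. fst p \<subseteq> underS W d} \<in> S d"
    by blast
  have "club W {d \<in> C. \<forall>p\<in>rare_patterns E T A.
      fst p \<subseteq> underS W d \<longrightarrow> realisers E T A p \<subseteq> underS W d}" (is "club W ?C'")
    by (rule club_realisers_of_rare_patterns_below[OF club_C])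
  then obtain d y where d: "d \<in> ?C'" and y: "y \<in> A" "d \<le>\<^sub>W y"
    and infinite_below: "infinite {x \<in> A. x <\<^sub>W d \<and> E x y}"
    using countably_colourable_if_finite_below_club[OF _ graph_E, of _ A] uncolourable by blast
  have "finitely_blocked (lower_neighbours E y) {p \<in> rare_patterns E T A. fst p \<subseteq> underS W d}"
    using meets_T y by (rule rare_patterns_below_finitely_blocked) (use d guessed in blast)+
  then obtain Z where "finite Z"
    and Z_blocks: "\<And>p. p \<in> rare_patterns E T A \<Longrightarrow> fst p \<subseteq> underS W d \<Longrightarrow>
      fst p \<subseteq> lower_neighbours E y \<Longrightarrow> fst p \<inter> Z \<noteq> {}"
    unfolding finitely_blocked_def by blast
  define X where "X = {x \<in> A. x <\<^sub>W d \<and> E x y} - Z"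
  have X: "X \<subseteq> underS W d" "X \<subseteq> lower_neighbours E y" "X \<inter> Z = {}"
    using y(2) wo.less_le_trans[of _ d y] by (auto simp: X_def lower_neighbours_def)
  show ?thesis
  proof
    show "infinite X" "X \<subseteq> A"
      using infinite_below \<open>finite Z\<close> by (auto simp: X_def)
    show "\<not> fst p \<subseteq> X" if "p \<in> rare_patterns E T A" for p
      using Z_blocks[OF that] X by blast
  qed
qed

theorem ex_half_graph_universal_orientation:
  fixes E :: "'w \<Rightarrow> 'w \<Rightarrow> bool"
  assumes "diamond_plus W" and graph_E: "graph UNIV E"
  obtains D where "orientation E D"
    and "\<And>A. \<not> countably_colourable E A \<Longrightarrow> half_graph_universal D A"
proof -
  obtain S where guesses_S: "guesses_pattern_sets S"
    using diamond_plus_guesses_pattern_sets[OF assms(1)] by blast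
  obtain T where meets_T: "meets_guesses S (lower_neighbours E) T"
    using ex_meets_guesses[OF guesses_S] by blast
  have "half_graph_universal (upward_orientation E T) A"
    if uncolourable: "\<not> countably_colourable E A" for A
  proof -
    obtain X where "infinite X" "X \<subseteq> A" "\<And>p. p \<in> rare_patterns E T A \<Longrightarrow> \<not> fst p \<subseteq> X"
      using ex_infinite_set_without_rare_patterns[OF guesses_S meets_T graph_E uncolourable]
      by blast
    then show ?thesis
      by (rule half_graph_universal_if_no_rare_patterns[OF graph_E])
  qed
  then show ?thesis
    using that orientation_upward_orientation[OF graph_E] by blast
qed

end

theorem theorem4p8:
  fixes W :: "'w rel" and V :: "'a set" and E :: "'a \<Rightarrow> 'a \<Rightarrow> bool"
  assumes "is_omega1 W"
    and "diamond_plus W"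
    and "graph V E"
    and "(card_of V, card_of (UNIV :: 'w set)) \<in> ordIso"
    and "chromatic_eq E V (UNIV :: 'w set)"
  shows "\<exists>Dstar. orientation E Dstar \<and>
           (\<forall>A. A \<subseteq> V \<and> chromatic_eq E A (UNIV :: 'w set) \<longrightarrow>
              (\<forall>D. orientation half_E D \<longrightarrow> embeds_into half_V D Dstar A))"
proof -
  interpret omega1 W
    by unfold_locales (use assms(1) in \<open>auto simp: is_omega1_def\<close>)
  obtain g :: "'w \<Rightarrow> 'a" where g: "inj g" "range g = V"
    using ordIso_symmetric[OF assms(4)] unfolding card_of_ordIso[symmetric] bij_betw_def by blast
  have "graph UNIV (\<lambda>a b. E (g a) (g b))"
    using assms(3) by (auto simp: graph_def)
  then obtain D where D: "orientation (\<lambda>a b. E (g a) (g b)) D"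
    and universal: "\<And>A. \<not> countably_colourable (\<lambda>a b. E (g a) (g b)) A \<Longrightarrow> half_graph_universal D A"
    using ex_half_graph_universal_orientation[OF assms(2)] by blast
  have "half_graph_universal (map_prod g g ` D) A"
    if "A \<subseteq> V" and chi: "chromatic_eq E A (UNIV :: 'w set)" for A
  proof -
    obtain A' where A': "A = g ` A'"
      using \<open>A \<subseteq> V\<close> g(2) by (metis subset_image_iff)
    then have "\<not> countably_colourable (\<lambda>a b. E (g a) (g b)) A'"
      using chromatic_eq_not_countably_colourable[OF chi uncountable_UNIV]
        countably_colourable_image[OF g(1), of E A'] by blast
    then show ?thesis
      unfolding A' by (intro half_graph_universal_map_prod[OF g(1)] universal)
  qed
  moreover have "orientation E (map_prod g g ` D)"
    by (rule orientation_map_prod[OF g(1) _ D]) (use assms(3) g(2) in \<open>auto simp: graph_def\<close>)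
  ultimately show ?thesis
    unfolding half_graph_universal_def by blast
qed

end
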